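(* Let $G_\sigma$ be a signed graph with no positive cycles, at least two edges, and no isolated vertex. The following are equivalent: (1) $G_\sigma$ is lift connected; (2) $G_\sigma$ contains no lift isthmus; (3) $G_\sigma$ has at least two cycles and no isthmus. Moreover, if $G_\sigma$ does not have at least two cycles, then every edge is a lift isthmus.
   Context: A signed graph $G_\sigma$ consists of a finite undirected graph, in which loops and multiple edges are allowed, with a sign $\pm1$ on each edge. Cycles are elementary; a loop is a cycle of length 1. The sign of a cycle is the product of its edge signs. The lift matroid $L(G_\sigma)$ on the edge set has as circuits the edge sets of: (i) positive cycles; (ii) unions of two negative cycles with exactly one common vertex; (iii$'$) unions of two vertex-disjoint negative cycles. A matroid is connected if every two elements lie in a common circuit. $G_\sigma$ is lift connected if $L(G_\sigma)$ is connected or $G_\sigma=K_1$. A lift isthmus is a coloop of $L(G_\sigma)$, i.e. an edge in no lift circuit. An isthmus is an edge whose deletion increases the number of connected components. *)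

theory Defs
  imports Main
begin

text \<open>
  A finite undirected graph with loops and multiple edges: edges are named, and each has a set of
  one (for a loop) or two endpoints.
\<close>

record ('v, 'e) signed_graph =
  verts :: "'v set"
  edges :: "'e set"
  ends :: "'e \<Rightarrow> 'v set"
  edge_sign :: "'e \<Rightarrow> int"

definition signed_graph :: "('v, 'e) signed_graph \<Rightarrow> bool" where
  "signed_graph G \<longleftrightarrow>
     finite (verts G) \<and> finite (edges G) \<and>
     (\<forall>e\<in>edges G. ends G e \<subseteq> verts G \<and> card (ends G e) \<in> {1, 2}) \<and>
     (\<forall>e\<in>edges G. edge_sign G e \<in> {1, -1})"

definition isolated_vertex :: "('v, 'e) signed_graph \<Rightarrow> 'v \<Rightarrow> bool" where
  "isolated_vertex G v \<longleftrightarrow> v \<in> verts G \<and> (\<forall>e\<in>edges G. v \<notin> ends G e)"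

definition is_K1 :: "('v, 'e) signed_graph \<Rightarrow> bool" where
  "is_K1 G \<longleftrightarrow> card (verts G) = 1 \<and> edges G = {}"

definition same_component :: "('v, 'e) signed_graph \<Rightarrow> ('v \<times> 'v) set" where
  "same_component G =
     {(u, v). u \<in> verts G \<and> v \<in> verts G \<and>
        (u, v) \<in> {(x, y). \<exists>e\<in>edges G. ends G e = {x, y}}\<^sup>*}"

definition num_components :: "('v, 'e) signed_graph \<Rightarrow> nat" where
  "num_components G = card (verts G // same_component G)"

definition delete_edge :: "('v, 'e) signed_graph \<Rightarrow> 'e \<Rightarrow> ('v, 'e) signed_graph" where
  "delete_edge G e = G\<lparr>edges := edges G - {e}\<rparr>"

definition isthmus :: "('v, 'e) signed_graph \<Rightarrow> 'e \<Rightarrow> bool" where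
  "isthmus G e \<longleftrightarrow> e \<in> edges G \<and> num_components (delete_edge G e) > num_components G"

text \<open>
  Elementary cycles, identified with their edge sets.  The indices are taken modulo the length, so
  length 1 gives a loop and length 2 a pair of distinct parallel edges.
\<close>

definition cycle :: "('v, 'e) signed_graph \<Rightarrow> 'e set \<Rightarrow> bool" where
  "cycle G C \<longleftrightarrow>
     (\<exists>vs es. es \<noteq> [] \<and> length vs = length es \<and> distinct vs \<and> distinct es \<and>
        set es \<subseteq> edges G \<and> C = set es \<and>
        (\<forall>i<length es. ends G (es ! i) = {vs ! i, vs ! (Suc i mod length es)}))"

definition cycle_verts :: "('v, 'e) signed_graph \<Rightarrow> 'e set \<Rightarrow> 'v set" where
  "cycle_verts G C = (\<Union>e\<in>C. ends G e)"

definition positive_cycle :: "('v, 'e) signed_graph \<Rightarrow> 'e set \<Rightarrow> bool" where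
  "positive_cycle G C \<longleftrightarrow> cycle G C \<and> (\<Prod>e\<in>C. edge_sign G e) = 1"

definition negative_cycle :: "('v, 'e) signed_graph \<Rightarrow> 'e set \<Rightarrow> bool" where
  "negative_cycle G C \<longleftrightarrow> cycle G C \<and> (\<Prod>e\<in>C. edge_sign G e) = -1"

text \<open>A matroid is represented by its ground set and its set of circuits.\<close>

record 'e circuit_matroid =
  ground :: "'e set"
  circuits :: "'e set set"

definition matroid_connected :: "'e circuit_matroid \<Rightarrow> bool" where
  "matroid_connected M \<longleftrightarrow>
     (\<forall>x\<in>ground M. \<forall>y\<in>ground M. x \<noteq> y \<longrightarrow> (\<exists>C\<in>circuits M. x \<in> C \<and> y \<in> C))"

definition coloop :: "'e circuit_matroid \<Rightarrow> 'e \<Rightarrow> bool" where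
  "coloop M e \<longleftrightarrow> e \<in> ground M \<and> (\<forall>C\<in>circuits M. e \<notin> C)"

text \<open>
  The condition \<open>C \<noteq> D\<close> is not redundant: a single negative loop has exactly one vertex in common
  with itself, but is not a circuit.
\<close>

definition lift_circuit :: "('v, 'e) signed_graph \<Rightarrow> 'e set \<Rightarrow> bool" where
  "lift_circuit G A \<longleftrightarrow>
     positive_cycle G A \<or>
     (\<exists>C D. negative_cycle G C \<and> negative_cycle G D \<and> C \<noteq> D \<and> A = C \<union> D \<and>
        card (cycle_verts G C \<inter> cycle_verts G D) = 1) \<or>
     (\<exists>C D. negative_cycle G C \<and> negative_cycle G D \<and> A = C \<union> D \<and>
        cycle_verts G C \<inter> cycle_verts G D = {})"

definition lift_matroid :: "('v, 'e) signed_graph \<Rightarrow> 'e circuit_matroid" where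
  "lift_matroid G = \<lparr>ground = edges G, circuits = {A. lift_circuit G A}\<rparr>"

definition lift_connected :: "('v, 'e) signed_graph \<Rightarrow> bool" where
  "lift_connected G \<longleftrightarrow> matroid_connected (lift_matroid G) \<or> is_K1 G"

definition lift_isthmus :: "('v, 'e) signed_graph \<Rightarrow> 'e \<Rightarrow> bool" where
  "lift_isthmus G e \<longleftrightarrow> coloop (lift_matroid G) e"

definition at_least_two_cycles :: "('v, 'e) signed_graph \<Rightarrow> bool" where
  "at_least_two_cycles G \<longleftrightarrow> card {C. cycle G C} \<ge> 2"

end

(* Without positive cycles there is no theta subgraph: the signs of the three cycles of a theta
   multiply to 1, while all three would be -1.  An arc of one cycle that leaves a second cycle
   and returns to it at another vertex would create a theta, so two distinct cycles share at most
   one vertex.  Hence the lift circuits are exactly the unions of two distinct cycles, and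
   everything reduces to the fact that an edge is an isthmus iff it lies on no cycle. *)
theory Submission
  imports Defs
begin

section \<open>Walks\<close>

text \<open>Each step records the edge as well as the vertex it reaches, because parallel edges
  cannot be told apart by their ends. The start \<open>u\<close> is kept outside the list, so a
  closed walk lists its base point only once, at the end.\<close>

fun walk :: "('e \<Rightarrow> 'v set) \<Rightarrow> 'v \<Rightarrow> ('e \<times> 'v) list \<Rightarrow> 'v \<Rightarrow> bool" where
  "walk f u [] v \<longleftrightarrow> u = v"
| "walk f u ((e, w) # p) v \<longleftrightarrow> f e = {u, w} \<and> walk f w p v"

lemma walk_append: "walk f u (p @ q) v \<longleftrightarrow> (\<exists>w. walk f u p w \<and> walk f w q v)"
  by (induction f u p v rule: walk.induct) auto

lemma walk_last: "walk f u p v \<Longrightarrow> v = last (u # map snd p)"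
  by (induction f u p v rule: walk.induct) auto

lemma walk_end_in: "walk f u p v \<Longrightarrow> v \<in> insert u (snd ` set p)"
  by (induction f u p v rule: walk.induct) auto

text \<open>Translates the recursion into the indexed form used by \<open>cycle_def\<close>.\<close>

lemma walk_nth:
  "walk f u p v \<longleftrightarrow>
     (\<forall>i<length p. f (fst (p ! i)) = {(u # map snd p) ! i, snd (p ! i)}) \<and>
     v = last (u # map snd p)"
  by (induction f u p v rule: walk.induct) (auto simp: All_less_Suc2)

lemma walk_ends: "walk f u p v \<Longrightarrow> (\<Union>e\<in>fst ` set p. f e) \<subseteq> insert u (snd ` set p)"
  by (induction f u p v rule: walk.induct) auto

lemma walk_snd_ends: "walk f u p v \<Longrightarrow> snd ` set p \<subseteq> (\<Union>e\<in>fst ` set p. f e)"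
  by (induction f u p v rule: walk.induct) auto

text \<open>A step stores its target, so reversing the list alone would pair edges with the wrong
  vertices; what gets reversed is the edge sequence and, separately, the vertex sequence with the
  start included.\<close>

lemma walk_reverse:
  "walk f u p v \<Longrightarrow>
     \<exists>q. walk f v q u \<and> map fst q = rev (map fst p) \<and> v # map snd q = rev (u # map snd p)"
proof (induction f u p v rule: walk.induct)
  case (2 f u e w p v)
  then obtain q where q: "walk f v q w" "map fst q = rev (map fst p)"
      "v # map snd q = rev (w # map snd p)"
    by auto
  have "walk f v (q @ [(e, u)]) u"
    using q(1) 2(2) by (auto simp: walk_append)
  moreover have "v # map snd (q @ [(e, u)]) = rev (u # map snd ((e, w) # p))"
    using q(3) by simp
  ultimately show ?case
    using q(2) by (intro exI[of _ "q @ [(e, u)]"]) auto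
qed auto

lemma walk_split_at:
  assumes "walk f u p v" "x \<in> insert u (snd ` set p)"
  shows "\<exists>p1 p2. p = p1 @ p2 \<and> walk f u p1 x \<and> walk f x p2 v"
  using assms
proof (induction f u p v rule: walk.induct)
  case (1 f u v)
  then show ?case by simp
next
  case (2 f u e w p v)
  show ?case
  proof (cases "x = u")
    case True
    then show ?thesis
      using "2.prems" by - (rule exI[of _ "[]"], rule exI[of _ "(e, w) # p"], auto)
  next
    case False
    then obtain p1 p2 where "p = p1 @ p2" "walk f w p1 x" "walk f x p2 v"
      using 2 by auto
    then show ?thesis
      using "2.prems" by - (rule exI[of _ "(e, w) # p1"], rule exI[of _ p2], auto)
  qed
qed

text \<open>The walk is cut at its first vertex in \<open>S\<close>. Every edge of \<open>q1\<close>
  then starts outside \<open>S\<close>, which later shows that it is not an edge of the cycle with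
  vertex set \<open>S\<close>.\<close>

lemma walk_first_hit:
  assumes "walk f b q a" "x \<in> insert b (snd ` set q)" "x \<in> S"
  shows "\<exists>q1 q2 w. q = q1 @ q2 \<and> walk f b q1 w \<and> walk f w q2 a \<and> w \<in> S \<and>
           insert b (snd ` set q1) \<inter> S = {w} \<and> (\<forall>d\<in>fst ` set q1. \<not> f d \<subseteq> S)"
  using assms
proof (induction f b q a rule: walk.induct)
  case (1 f u v)
  then show ?case by - (rule exI[of _ "[]"], rule exI[of _ "[]"], rule exI[of _ u], auto)
next
  case (2 f u e w p v)
  show ?case
  proof (cases "u \<in> S")
    case True
    then show ?thesis
      using "2.prems"
      by - (rule exI[of _ "[]"], rule exI[of _ "(e, w) # p"], rule exI[of _ u], auto)
  next
    case False
    then have "x \<in> insert w (snd ` set p)" using "2.prems" by auto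
    then obtain q1 q2 y where "p = q1 @ q2" "walk f w q1 y" "walk f y q2 v" "y \<in> S"
        "insert w (snd ` set q1) \<inter> S = {y}" "\<forall>d\<in>fst ` set q1. \<not> f d \<subseteq> S"
      using "2.IH" "2.prems" by auto
    then show ?thesis
      using "2.prems" False
      by - (rule exI[of _ "(e, w) # q1"], rule exI[of _ q2], rule exI[of _ y], auto)
  qed
qed

text \<open>Dual to the first hit, with induction from the right end: after the last visit to
  \<open>S\<close> every edge leads to a vertex outside \<open>S\<close>.\<close>

lemma walk_last_hit:
  assumes "walk f w q a" "w \<in> S"
  shows "\<exists>q1 q2 u. q = q1 @ q2 \<and> walk f w q1 u \<and> walk f u q2 a \<and> u \<in> S \<and>
           snd ` set q2 \<inter> S = {} \<and> (\<forall>d\<in>fst ` set q2. \<not> f d \<subseteq> S)"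
  using assms
proof (induction q arbitrary: a rule: rev_induct)
  case Nil
  then show ?case by - (rule exI[of _ "[]"], rule exI[of _ "[]"], rule exI[of _ w], auto)
next
  case (snoc s q)
  obtain e y where s: "s = (e, y)" by (cases s)
  then have y: "y = a" using snoc.prems by (auto simp: walk_append)
  show ?case
  proof (cases "a \<in> S")
    case True
    then show ?thesis
      using snoc.prems by - (rule exI[of _ "q @ [s]"], rule exI[of _ "[]"], rule exI[of _ a], auto)
  next
    case False
    obtain z where z: "walk f w q z" "f e = {z, a}"
      using snoc.prems s y by (auto simp: walk_append)
    obtain q1 q2 u where "q = q1 @ q2" "walk f w q1 u" "walk f u q2 z" "u \<in> S"
        "snd ` set q2 \<inter> S = {}" "\<forall>d\<in>fst ` set q2. \<not> f d \<subseteq> S"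
      using snoc.IH[OF z(1) snoc.prems(2)] by auto
    then show ?thesis
      using z s y False
      by - (rule exI[of _ q1], rule exI[of _ "q2 @ [s]"], rule exI[of _ u], auto simp: walk_append)
  qed
qed

text \<open>Loop erasure: if the vertex prepended to a simple walk already lies on it, only the part
  from that vertex onwards is kept.\<close>

lemma rtrancl_imp_simple_walk:
  assumes "(u, v) \<in> {(x, y). \<exists>e\<in>F. f e = {x, y}}\<^sup>*"
  shows "\<exists>p. walk f u p v \<and> distinct (u # map snd p) \<and> fst ` set p \<subseteq> F"
  using assms
proof (induction rule: converse_rtrancl_induct)
  case base
  show ?case by (intro exI[of _ "[]"]) auto
next
  case (step u w)
  obtain p where p: "walk f w p v" "distinct (w # map snd p)" "fst ` set p \<subseteq> F"
    using step.IH by blast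
  obtain e where e: "e \<in> F" "f e = {u, w}" using step.hyps(1) by blast
  show ?case
  proof (cases "u \<in> insert w (snd ` set p)")
    case True
    then obtain p1 p2 where s: "p = p1 @ p2" "walk f w p1 u" "walk f u p2 v"
      using walk_split_at[OF p(1)] by blast
    \<comment> \<open>As the endpoint of \<open>p1\<close>, \<open>u\<close> already occurs in the
      simple walk up to the cut, so it cannot recur in \<open>p2\<close>.\<close>
    have "u \<in> insert w (snd ` set p1)" using walk_end_in[OF s(2)] .
    then have "distinct (u # map snd p2)" using p(2) s(1) by auto
    then show ?thesis using s p(3) by (intro exI[of _ p2]) auto
  next
    case False
    then show ?thesis using p e by (intro exI[of _ "(e, w) # p"]) auto
  qed
qed

lemma walk_imp_rtrancl:
  "walk f u p v \<Longrightarrow> fst ` set p \<subseteq> F \<Longrightarrow> (u, v) \<in> {(x, y). \<exists>e\<in>F. f e = {x, y}}\<^sup>*"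
proof (induction f u p v rule: walk.induct)
  case (2 f u e w p v)
  let ?R = "{(x, y). \<exists>e\<in>F. f e = {x, y}}"
  have "(u, w) \<in> ?R" using "2.prems" by auto
  moreover have "(w, v) \<in> ?R\<^sup>*" using 2 by simp
  ultimately show ?case by (rule converse_rtrancl_into_rtrancl)
qed simp

text \<open>If the first edge were used again, both its ends, \<open>u\<close> among them, would
  occur among the later vertices.\<close>

lemma simple_walk_distinct_edges:
  "walk f u p v \<Longrightarrow> distinct (u # map snd p) \<Longrightarrow> distinct (map fst p)"
proof (induction f u p v rule: walk.induct)
  case (2 f u e w p v)
  have "e \<notin> fst ` set p"
  proof
    assume "e \<in> fst ` set p"
    then have "f e \<subseteq> insert w (snd ` set p)"
      using walk_ends[of f w p v] "2.prems"(1) by auto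
    then show False using "2.prems" by auto
  qed
  then show ?case using 2 by auto
qed auto

section \<open>Cycles as closed walks\<close>

text \<open>Distinctness of the edges rules out running along one edge and back, which would satisfy
  the vertex condition with length 2.\<close>

definition cycle_walk :: "('e \<Rightarrow> 'v set) \<Rightarrow> 'v \<Rightarrow> ('e \<times> 'v) list \<Rightarrow> bool" where
  "cycle_walk f u p \<longleftrightarrow> p \<noteq> [] \<and> walk f u p u \<and> distinct (map snd p) \<and> distinct (map fst p)"

text \<open>Trades indices modulo the length for lists that can be cut and appended.\<close>

lemma cycle_iff_cycle_walk:
  "cycle G C \<longleftrightarrow> (\<exists>u p. cycle_walk (ends G) u p \<and> C = fst ` set p \<and> C \<subseteq> edges G)"
proof
  assume "cycle G C"
  then obtain vs es where c: "es \<noteq> []" "length vs = length es" "distinct vs" "distinct es"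
      "set es \<subseteq> edges G" "C = set es"
      "\<And>i. i < length es \<Longrightarrow> ends G (es ! i) = {vs ! i, vs ! (Suc i mod length es)}"
    unfolding cycle_def by blast
  then obtain u ws where vs: "vs = u # ws" by (cases vs) auto
  \<comment> \<open>\<open>vs\<close> lists the sources of the edges while a walk stores targets,
    hence the shift by one.\<close>
  define p where "p = zip es (rotate1 vs)"
  have m: "map fst p = es" "map snd p = rotate1 vs" "length p = length es"
    using c(2) by (auto simp: p_def)
  have "ends G (fst (p ! i)) = {(u # map snd p) ! i, snd (p ! i)}" if "i < length p" for i
  proof -
    have "fst (p ! i) = es ! i" "snd (p ! i) = vs ! (Suc i mod length es)"
      using that m(3) c(2) by (simp_all add: p_def nth_rotate1)
    moreover have "(u # map snd p) ! i = vs ! i"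
      using that m(3) c(2) vs unfolding m(2) vs
      by (cases i) (simp_all add: nth_append)
    ultimately show ?thesis using c(7) that m(3) by simp
  qed
  moreover have "u = last (u # map snd p)" using vs m(2) by simp
  ultimately have "walk (ends G) u p u" by (subst walk_nth) auto
  then have "cycle_walk (ends G) u p"
    using m c(1,3,4) by (auto simp: cycle_walk_def simp del: map_map)
  moreover have "fst ` set p = C" using m(1) c(6) by (metis set_map)
  ultimately show "\<exists>u p. cycle_walk (ends G) u p \<and> C = fst ` set p \<and> C \<subseteq> edges G"
    using c(5,6) by metis
next
  assume "\<exists>u p. cycle_walk (ends G) u p \<and> C = fst ` set p \<and> C \<subseteq> edges G"
  then obtain u p where p: "p \<noteq> []" "walk (ends G) u p u" "distinct (map snd p)"
      "distinct (map fst p)" "C = fst ` set p" "C \<subseteq> edges G"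
    by (auto simp: cycle_walk_def)
  \<comment> \<open>The inverse shift: the last target is \<open>u\<close> itself, so it is dropped
    at the end and put in front.\<close>
  define vs where "vs = u # butlast (map snd p)"
  have u: "u = last (map snd p)" using walk_last[OF p(2)] p(1) by simp
  have r: "rotate1 vs = map snd p"
    unfolding vs_def rotate1.simps u using p(1) by (intro append_butlast_last_id) auto
  have len: "length vs = length p" using r by (metis length_map length_rotate1)
  have "ends G (map fst p ! i) = {vs ! i, vs ! (Suc i mod length p)}" if "i < length p" for i
  proof -
    have "snd (p ! i) = vs ! (Suc i mod length p)"
      using that len nth_rotate1[of i vs] r by simp
    moreover have "(u # map snd p) ! i = vs ! i"
      using that len by (cases i) (auto simp: vs_def nth_butlast)
    ultimately show ?thesis using p(2) that by (subst (asm) walk_nth) simp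
  qed
  moreover have "distinct vs" using p(3) r by (metis distinct1_rotate)
  ultimately show "cycle G C"
    unfolding cycle_def using p len
    by - (rule exI[of _ vs], rule exI[of _ "map fst p"], auto)
qed

lemma cycle_walkI:
  assumes "cycle_walk (ends G) u p" "fst ` set p \<subseteq> edges G"
  shows "cycle G (fst ` set p)"
  using assms cycle_iff_cycle_walk by blast

lemma cycle_verts_cycle_walk:
  assumes "cycle_walk (ends G) u p"
  shows "cycle_verts G (fst ` set p) = snd ` set p"
proof -
  have w: "walk (ends G) u p u" "p \<noteq> []" using assms by (auto simp: cycle_walk_def)
  have "u \<in> snd ` set p" using walk_last[OF w(1)] w(2) by (metis last_ConsR last_in_set
        list.set_map map_is_Nil_conv)
  then show ?thesis
    using walk_ends[OF w(1)] walk_snd_ends[OF w(1)] by (auto simp: cycle_verts_def)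
qed

lemma cycle_walk_rotate:
  assumes "cycle_walk f u (p @ q)" "walk f u p w" "walk f w q u"
  shows "cycle_walk f w (q @ p)"
  using assms by (auto simp: cycle_walk_def walk_append)

text \<open>Any vertex of the cycle can serve as base point: cut there and exchange the two
  pieces.\<close>

lemma cycle_walk_at_vertex:
  assumes "cycle G C" "x \<in> cycle_verts G C"
  obtains p where "cycle_walk (ends G) x p" "C = fst ` set p" "C \<subseteq> edges G"
proof -
  obtain u p where p: "cycle_walk (ends G) u p" "C = fst ` set p" "C \<subseteq> edges G"
    using assms(1) cycle_iff_cycle_walk by metis
  then have "x \<in> insert u (snd ` set p)"
    using assms(2) cycle_verts_cycle_walk by fastforce
  then obtain p1 p2 where s: "p = p1 @ p2" "walk (ends G) u p1 x" "walk (ends G) x p2 u"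
    using p(1) walk_split_at[of "ends G" u p u x] unfolding cycle_walk_def by metis
  then have "cycle_walk (ends G) x (p2 @ p1)" using cycle_walk_rotate p(1) by metis
  moreover have "C = fst ` set (p2 @ p1)" using p(2) s(1) by auto
  ultimately show ?thesis using p(3) that by blast
qed

text \<open>Rotating the cycle so that it opens with \<open>e\<close> leaves \<open>p\<close> as the
  way from \<open>v\<close> back to \<open>u\<close> that avoids \<open>e\<close>.\<close>

lemma cycle_walk_at_edge:
  assumes "cycle G C" "e \<in> C"
  obtains u v p where "cycle_walk (ends G) u ((e, v) # p)" "C = fst ` set ((e, v) # p)"
    "C \<subseteq> edges G"
proof -
  obtain u p where p: "cycle_walk (ends G) u p" "C = fst ` set p" "C \<subseteq> edges G"
    using assms(1) cycle_iff_cycle_walk by metis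
  then obtain v where "(e, v) \<in> set p" using assms(2) by auto
  then obtain p1 p2 where s: "p = p1 @ (e, v) # p2" by (metis split_list)
  then obtain w where w: "walk (ends G) u p1 w" "walk (ends G) w ((e, v) # p2) u"
    using p(1) unfolding s cycle_walk_def walk_append by blast
  then have "cycle_walk (ends G) w ((e, v) # p2 @ p1)"
    using cycle_walk_rotate p(1) s by fastforce
  moreover have "C = fst ` set ((e, v) # p2 @ p1)" using p(2) s by auto
  ultimately show ?thesis using p(3) that by blast
qed

section \<open>Two cycles share at most one vertex\<close>

lemma edge_sign_prod:
  assumes "signed_graph G" "A \<subseteq> edges G"
  shows "(\<Prod>e\<in>A. edge_sign G e) \<in> {1, -1}"
proof -
  have "finite A" using assms finite_subset unfolding signed_graph_def by blast
  then show ?thesis using assms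
    by (induction A rule: finite_induct) (auto simp: signed_graph_def)
qed

text \<open>The vertices \<open>u\<close> and \<open>w\<close> cut \<open>C\<close> into arcs
  \<open>A\<close> and \<open>B\<close>, and any two of \<open>A\<close>, \<open>B\<close>,
  \<open>P\<close> form a cycle. Among three signs in {1, -1} two agree, and the corresponding cycle
  is positive.\<close>

lemma theta_positive_cycle:
  assumes G: "signed_graph G"
    and C: "cycle G C"
    and uw: "u \<in> cycle_verts G C" "w \<in> cycle_verts G C" "u \<noteq> w"
    and P: "walk (ends G) u P w" "distinct (map snd P)" "distinct (map fst P)"
      "fst ` set P \<subseteq> edges G"
    and ear: "fst ` set P \<inter> C = {}" "snd ` set P \<inter> cycle_verts G C \<subseteq> {w}"
  shows "\<exists>D. positive_cycle G D"
proof (rule ccontr)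
  assume no_pos: "\<not> ?thesis"
  let ?s = "\<lambda>A. \<Prod>e\<in>A. edge_sign G e"
  obtain c where c: "cycle_walk (ends G) u c" "C = fst ` set c" "C \<subseteq> edges G"
    using cycle_walk_at_vertex[OF C uw(1)] by metis
  have V: "cycle_verts G C = snd ` set c" using cycle_verts_cycle_walk c by metis
  then obtain A B where AB: "c = A @ B" "walk (ends G) u A w" "walk (ends G) w B u"
    using c(1) uw(2) walk_split_at[of "ends G" u c u w] unfolding cycle_walk_def by blast
  obtain A' where A': "walk (ends G) w A' u" "map fst A' = rev (map fst A)"
      "w # map snd A' = rev (u # map snd A)"
    using walk_reverse[OF AB(2)] by metis
  have dc: "distinct (map snd (A @ B))" "distinct (map fst (A @ B))"
    using c(1) AB(1) by (auto simp: cycle_walk_def)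
  have wA: "w \<in> snd ` set A" using walk_end_in[OF AB(2)] uw(3) by auto
  have uB: "u \<in> snd ` set B" using walk_end_in[OF AB(3)] uw(3) by auto
  have "distinct (rev (u # map snd A))" using dc(1) uB by auto
  then have dA': "distinct (w # map snd A')" using A'(3) by metis
  have sA': "set (w # map snd A') = set (u # map snd A)" using A'(3) by (metis set_rev)
  have fA': "fst ` set A' = fst ` set A" using A'(2) by (metis set_map set_rev)
  have Pne: "P \<noteq> []" using P(1) uw(3) by auto
  have "cycle_walk (ends G) u (P @ B)"
  proof -
    \<comment> \<open>\<open>w\<close> is already listed as the endpoint of \<open>A\<close>. Since
      \<open>w\<close> is the only vertex of \<open>C\<close> that \<open>P\<close> may list,
      \<open>P\<close> and \<open>B\<close> list no common vertex.\<close>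
    have "w \<notin> snd ` set B" using wA dc(1) by auto
    then have "snd ` set P \<inter> snd ` set B = {}" using ear(2) V AB(1) by auto
    moreover have "fst ` set P \<inter> fst ` set B = {}" using ear(1) c(2) AB(1) by auto
    ultimately show ?thesis
      using P AB(3) dc Pne unfolding cycle_walk_def by (auto simp: walk_append)
  qed
  moreover have "cycle_walk (ends G) u (P @ A')"
  proof -
    have "snd ` set A' \<subseteq> cycle_verts G C" using sA' V AB(1) uB by auto
    then have "snd ` set P \<inter> snd ` set A' = {}" using ear(2) dA' by auto
    moreover have "fst ` set P \<inter> fst ` set A' = {}" using fA' ear(1) c(2) AB(1) by auto
    moreover have "distinct (map fst A')" using A'(2) dc(2) by simp
    ultimately show ?thesis
      using P A'(1) dA' Pne unfolding cycle_walk_def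
      by (auto simp: walk_append)
  qed
  moreover have sub: "fst ` set A \<subseteq> edges G" "fst ` set B \<subseteq> edges G"
    using c AB(1) by auto
  ultimately have "cycle G (fst ` set P \<union> fst ` set B)" "cycle G (fst ` set P \<union> fst ` set A)"
    using cycle_walkI[of G u "P @ B"] cycle_walkI[of G u "P @ A'"] P(4) fA'
    by (auto simp: image_Un)
  then have "?s (fst ` set P \<union> fst ` set B) \<noteq> 1" "?s (fst ` set P \<union> fst ` set A) \<noteq> 1"
    using no_pos by (auto simp: positive_cycle_def)
  moreover have "?s (fst ` set A \<union> fst ` set B) \<noteq> 1"
    using no_pos C c(2) AB(1) by (auto simp: positive_cycle_def image_Un)
  moreover have "fst ` set A \<inter> fst ` set B = {}" using dc(2) by auto
  moreover have "fst ` set P \<inter> fst ` set A = {}" "fst ` set P \<inter> fst ` set B = {}"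
    using ear(1) c(2) AB(1) by auto
  ultimately have "?s (fst ` set P) * ?s (fst ` set B) \<noteq> 1"
      "?s (fst ` set P) * ?s (fst ` set A) \<noteq> 1" "?s (fst ` set A) * ?s (fst ` set B) \<noteq> 1"
    by (simp_all add: prod.union_disjoint)
  then show False
    using edge_sign_prod[OF G P(4)] edge_sign_prod[OF G sub(1)] edge_sign_prod[OF G sub(2)]
    by auto
qed

text \<open>Open \<open>D\<close> at \<open>e\<close> and follow the rest from \<open>b\<close> to
  \<open>a\<close>. With \<open>w\<close> the first and \<open>u\<close> the last vertex on
  \<open>C\<close>, the part of \<open>D\<close> from \<open>u\<close> through \<open>e\<close> to
  \<open>w\<close> is an ear of \<open>C\<close>. If \<open>e\<close> is a chord, the ear is
  \<open>e\<close> alone.\<close>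

lemma cycle_ear:
  assumes C: "cycle G C" and D: "cycle G D" "e \<in> D" "e \<notin> C"
    and xy: "x \<in> cycle_verts G C" "x \<in> cycle_verts G D" "y \<in> cycle_verts G C"
      "y \<in> cycle_verts G D" "x \<noteq> y"
  obtains u w P where "u \<in> cycle_verts G C" "w \<in> cycle_verts G C" "u \<noteq> w"
    "walk (ends G) u P w" "distinct (map snd P)" "distinct (map fst P)"
    "fst ` set P \<subseteq> edges G" "fst ` set P \<inter> C = {}" "snd ` set P \<inter> cycle_verts G C \<subseteq> {w}"
proof -
  let ?S = "cycle_verts G C"
  obtain a b q where d: "cycle_walk (ends G) a ((e, b) # q)" "D = fst ` set ((e, b) # q)"
      "D \<subseteq> edges G"
    using cycle_walk_at_edge[OF D(1,2)] by metis
  have VD: "cycle_verts G D = insert b (snd ` set q)"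
    using cycle_verts_cycle_walk[OF d(1)] d(2) by simp
  have q: "ends G e = {a, b}" "walk (ends G) b q a" "distinct (b # map snd q)"
      "distinct (e # map fst q)"
    using d(1) by (auto simp: cycle_walk_def)
  obtain q1 r w where w: "q = q1 @ r" "walk (ends G) b q1 w" "walk (ends G) w r a" "w \<in> ?S"
      "insert b (snd ` set q1) \<inter> ?S = {w}" "\<forall>d\<in>fst ` set q1. \<not> ends G d \<subseteq> ?S"
    using walk_first_hit[OF q(2), of x ?S] xy(1,2) VD by auto
  obtain q2 q3 u where u: "r = q2 @ q3" "walk (ends G) w q2 u" "walk (ends G) u q3 a" "u \<in> ?S"
      "snd ` set q3 \<inter> ?S = {}" "\<forall>d\<in>fst ` set q3. \<not> ends G d \<subseteq> ?S"
    using walk_last_hit[OF w(3,4)] by auto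
  \<comment> \<open>Otherwise \<open>D\<close> would meet \<open>C\<close> in \<open>w\<close> only,
    against the two common vertices \<open>x\<close> and \<open>y\<close>.\<close>
  have "u \<noteq> w"
  proof
    assume "u = w"
    \<comment> \<open>A nonempty closed piece \<open>q2\<close> would list \<open>w\<close> a second
      time on the cycle \<open>D\<close>.\<close>
    have "q2 = []"
    proof (rule ccontr)
      assume "q2 \<noteq> []"
      then have "u \<in> snd ` set q2"
        using walk_last[OF u(2)] by (metis last_ConsR last_in_set list.set_map map_is_Nil_conv)
      moreover have "w \<in> insert b (snd ` set q1)" using w(5) by auto
      ultimately show False using q(3) w(1) u(1) \<open>u = w\<close> by auto
    qed
    then have "cycle_verts G D \<inter> ?S = {w}" using VD w(1,5) u(1,5) by auto
    then show False using xy by (metis IntI singletonD)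
  qed
  moreover have "walk (ends G) u (q3 @ (e, b) # q1) w"
    using u(3) q(1) w(2) by (auto simp: walk_append)
  moreover have "distinct (map snd (q3 @ (e, b) # q1))" "distinct (map fst (q3 @ (e, b) # q1))"
    using q(3,4) w(1) u(1) by auto
  moreover have "fst ` set (q3 @ (e, b) # q1) \<subseteq> edges G"
    using d(2,3) w(1) u(1) by auto
  \<comment> \<open>The edges of \<open>q1\<close> and \<open>q3\<close> have an end off
    \<open>C\<close>; for \<open>e\<close>, which may have both ends on \<open>C\<close>, the
    hypothesis \<open>e \<notin> C\<close> decides.\<close>
  moreover have "fst ` set (q3 @ (e, b) # q1) \<inter> C = {}"
  proof -
    have "ends G d \<subseteq> ?S" if "d \<in> C" for d using that by (auto simp: cycle_verts_def)
    then show ?thesis using w(6) u(6) D(3) by fastforce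
  qed
  moreover have "snd ` set (q3 @ (e, b) # q1) \<inter> ?S \<subseteq> {w}" using w(5) u(5) by auto
  ultimately show ?thesis by (rule that[OF u(4) w(4)])
qed

lemma distinct_cycles_share_at_most_one_vertex:
  assumes G: "signed_graph G" "\<not> (\<exists>C. positive_cycle G C)"
    and "cycle G C" "cycle G D" "C \<noteq> D"
    and "x \<in> cycle_verts G C \<inter> cycle_verts G D" "y \<in> cycle_verts G C \<inter> cycle_verts G D"
  shows "x = y"
proof (rule ccontr)
  assume xy: "x \<noteq> y"
  \<comment> \<open>Stated for fresh cycles because the edge that tells \<open>C\<close> and
    \<open>D\<close> apart may lie in either of them.\<close>
  have False if "cycle G C" "cycle G D" "e \<in> D" "e \<notin> C"
      "x \<in> cycle_verts G C" "x \<in> cycle_verts G D" "y \<in> cycle_verts G C" "y \<in> cycle_verts G D"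
    for C D e
    using cycle_ear[OF that xy] theta_positive_cycle[OF G(1) that(1)] G(2) by metis
  moreover obtain e where "e \<in> D \<and> e \<notin> C \<or> e \<in> C \<and> e \<notin> D" using assms(5) by blast
  ultimately show False using assms(3,4,6,7) by blast
qed

section \<open>Lift circuits in the absence of positive cycles\<close>

lemma negative_cycle_iff_cycle:
  assumes "signed_graph G" "\<not> (\<exists>C. positive_cycle G C)"
  shows "negative_cycle G C \<longleftrightarrow> cycle G C"
proof -
  have "C \<subseteq> edges G" if "cycle G C" using that by (auto simp: cycle_def)
  then show ?thesis
    using assms edge_sign_prod[of G C] by (auto simp: negative_cycle_def positive_cycle_def)
qed

lemma cycle_verts_nonempty: "cycle G C \<Longrightarrow> cycle_verts G C \<noteq> {}"
  using cycle_iff_cycle_walk[of G C] cycle_verts_cycle_walk[of G]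
  by (fastforce simp: cycle_walk_def)

text \<open>All cycles are negative and two distinct ones meet in at most one vertex, so every pair
  of distinct cycles falls under (ii) or (iii').\<close>

lemma lift_circuit_iff:
  assumes "signed_graph G" "\<not> (\<exists>C. positive_cycle G C)"
  shows "lift_circuit G A \<longleftrightarrow> (\<exists>C D. cycle G C \<and> cycle G D \<and> C \<noteq> D \<and> A = C \<union> D)"
proof
  assume "lift_circuit G A"
  \<comment> \<open>In the vertex-disjoint case \<open>C \<noteq> D\<close> has to be derived: a
    cycle has a vertex, so it is not disjoint from itself.\<close>
  then show "\<exists>C D. cycle G C \<and> cycle G D \<and> C \<noteq> D \<and> A = C \<union> D"
    using assms cycle_verts_nonempty[of G]
    unfolding lift_circuit_def negative_cycle_iff_cycle[OF assms]
    by (metis inf.idem)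
next
  assume "\<exists>C D. cycle G C \<and> cycle G D \<and> C \<noteq> D \<and> A = C \<union> D"
  then obtain C D where CD: "cycle G C" "cycle G D" "C \<noteq> D" "A = C \<union> D" by blast
  let ?I = "cycle_verts G C \<inter> cycle_verts G D"
  have "card ?I = 1" if I: "?I \<noteq> {}"
  proof -
    obtain x where "x \<in> ?I" using I by blast
    then have "?I = {x}"
      using distinct_cycles_share_at_most_one_vertex[OF assms CD(1-3)] by blast
    then show ?thesis by simp
  qed
  then show "lift_circuit G A"
    unfolding lift_circuit_def negative_cycle_iff_cycle[OF assms] using CD by blast
qed

section \<open>Isthmuses\<close>

lemma equiv_same_component: "equiv (verts G) (same_component G)"
proof (rule equivI)
  show "same_component G \<subseteq> verts G \<times> verts G" by (auto simp: same_component_def)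
  show "refl_on (verts G) (same_component G)"
    by (auto simp: refl_on_def same_component_def)
  have "sym {(x, y). \<exists>e\<in>edges G. ends G e = {x, y}}"
    by (auto simp: sym_def insert_commute)
  then have "sym ({(x, y). \<exists>e\<in>edges G. ends G e = {x, y}}\<^sup>*)" by (rule sym_rtrancl)
  then show "sym (same_component G)"
    by (auto intro!: symI dest: symD simp: same_component_def)
  show "trans (same_component G)"
    by (auto intro!: transI intro: rtrancl_trans simp: same_component_def)
qed

text \<open>Sending an \<open>R'\<close>-class to the \<open>R\<close>-class containing it is onto,
  and a pair in \<open>R\<close> but not in \<open>R'\<close> gives two classes that are
  merged.\<close>

lemma card_quotient_less:
  assumes "finite V" "equiv V R" "equiv V R'" "R' \<subset> R"
  shows "card (V // R) < card (V // R')"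
proof -
  let ?h = "\<lambda>X. R `` X"
  have cls: "?h (R' `` {x}) = R `` {x}" if "x \<in> V" for x
  proof -
    have "R' `` {x} \<subseteq> R `` {x}" "x \<in> R' `` {x}"
      using assms(4) equiv_class_self[OF assms(3) that] by auto
    then show ?thesis using assms(2) unfolding equiv_def trans_def by blast
  qed
  have im: "?h ` (V // R') = V // R"
  proof
    show "?h ` (V // R') \<subseteq> V // R"
      using cls by (auto simp: quotient_def)
    show "V // R \<subseteq> ?h ` (V // R')"
    proof
      fix X assume "X \<in> V // R"
      then obtain x where x: "x \<in> V" "X = R `` {x}" by (rule quotientE)
      show "X \<in> ?h ` (V // R')"
        using x cls by (intro image_eqI[OF _ quotientI[OF x(1)]]) simp
    qed
  qed
  have fin: "finite (V // R')"
    using assms(1,3) by (simp add: quotient_def)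
  obtain x y where xy: "(x, y) \<in> R" "(x, y) \<notin> R'" using assms(4) by auto
  then have V: "x \<in> V" "y \<in> V" using assms(2) by (auto simp: equiv_def refl_on_def)
  have "R `` {x} = R `` {y}" using equiv_class_eq[OF assms(2) xy(1)] .
  moreover have "R' `` {x} \<noteq> R' `` {y}"
    using xy(2) eq_equiv_class_iff[OF assms(3) V] by auto
  ultimately have "\<not> inj_on ?h (V // R')"
    using cls V by (metis inj_onD quotientI)
  then show ?thesis
    using im fin card_image_le[OF fin, of ?h] eq_card_imp_inj_on[OF fin, of ?h]
    by (metis le_neq_implies_less)
qed

text \<open>Deleting \<open>e\<close> keeps the components exactly when its ends stay joined, and a
  path joining them without \<open>e\<close> closes up with \<open>e\<close> to a cycle.\<close>

lemma isthmus_iff_no_cycle: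
  assumes G: "signed_graph G" and e: "e \<in> edges G"
  shows "isthmus G e \<longleftrightarrow> \<not> (\<exists>C. cycle G C \<and> e \<in> C)"
proof -
  let ?H = "delete_edge G e"
  let ?S = "\<lambda>F. {(x, y). \<exists>d\<in>F. ends G d = {x, y}}"
  have H: "verts ?H = verts G" "edges ?H = edges G - {e}" "ends ?H = ends G"
    by (auto simp: delete_edge_def)
  have sub: "same_component ?H \<subseteq> same_component G"
    using rtrancl_mono[of "?S (edges G - {e})" "?S (edges G)"]
    by (auto simp: same_component_def H)
  obtain a b where ab: "ends G e = {a, b}"
    using G e by (auto simp: signed_graph_def card_1_singleton_iff card_2_iff)
  have abV: "a \<in> verts G" "b \<in> verts G" using G e ab by (auto simp: signed_graph_def)
  show ?thesis
  proof
    assume I: "isthmus G e"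
    show "\<not> (\<exists>C. cycle G C \<and> e \<in> C)"
    proof
      assume "\<exists>C. cycle G C \<and> e \<in> C"
      then obtain C u v p where p: "cycle_walk (ends G) u ((e, v) # p)"
          "C = fst ` set ((e, v) # p)" "C \<subseteq> edges G"
        by (metis cycle_walk_at_edge)
      have vp: "walk (ends G) v p u" "fst ` set p \<subseteq> edges G - {e}" and uv: "ends G e = {u, v}"
        using p by (auto simp: cycle_walk_def)
      have vu: "(v, u) \<in> (?S (edges G - {e}))\<^sup>*" by (rule walk_imp_rtrancl[OF vp])
      have "sym (?S (edges G - {e}))" by (auto simp: sym_def insert_commute)
      then have *: "(u, v) \<in> (?S (edges G - {e}))\<^sup>*" by (rule symD[OF sym_rtrancl vu])
      \<comment> \<open>The rest of the cycle is a detour around \<open>e\<close>, so adjacency in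
        \<open>G\<close> implies reachability after the deletion.\<close>
      have "?S (edges G) \<subseteq> (?S (edges G - {e}))\<^sup>*"
      proof (rule subrelI)
        fix x y assume "(x, y) \<in> ?S (edges G)"
        then obtain d where d: "d \<in> edges G" "ends G d = {x, y}" by auto
        show "(x, y) \<in> (?S (edges G - {e}))\<^sup>*"
        proof (cases "d = e")
          case True
          then show ?thesis using d(2) uv vu * by (auto simp: doubleton_eq_iff)
        next
          case False
          then show ?thesis using d by (intro r_into_rtrancl) auto
        qed
      qed
      then have "(?S (edges G))\<^sup>* \<subseteq> (?S (edges G - {e}))\<^sup>*"
        by (rule rtrancl_subset_rtrancl)
      then have "same_component G \<subseteq> same_component ?H"
        by (auto simp: same_component_def H)
      then have "num_components ?H = num_components G"
        using sub by (simp add: num_components_def H)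
      then show False using I by (simp add: isthmus_def)
    qed
  next
    assume N: "\<not> (\<exists>C. cycle G C \<and> e \<in> C)"
    \<comment> \<open>A simple path from \<open>b\<close> to \<open>a\<close> would complete
      \<open>e\<close> to a cycle. For a loop the path is empty and \<open>e\<close> alone is the
      cycle.\<close>
    have "(b, a) \<notin> same_component ?H"
    proof
      assume "(b, a) \<in> same_component ?H"
      then have "(b, a) \<in> (?S (edges G - {e}))\<^sup>*" by (auto simp: same_component_def H)
      then obtain p where p: "walk (ends G) b p a" "distinct (b # map snd p)"
          "fst ` set p \<subseteq> edges G - {e}"
        using rtrancl_imp_simple_walk[of b a "edges G - {e}" "ends G"] by auto
      have "cycle_walk (ends G) a ((e, b) # p)"
        using p ab simple_walk_distinct_edges[OF p(1,2)] by (auto simp: cycle_walk_def)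
      then have "cycle G (fst ` set ((e, b) # p))"
        using p(3) e by (intro cycle_walkI) auto
      then show False using N by fastforce
    qed
    moreover have "(b, a) \<in> same_component G"
      using abV ab e by (auto simp: same_component_def insert_commute)
    ultimately have "same_component ?H \<subset> same_component G" using sub by auto
    then show "isthmus G e"
      using card_quotient_less[OF _ equiv_same_component[of G], of "same_component ?H"]
        equiv_same_component[of ?H] G e
      by (simp add: isthmus_def num_components_def H signed_graph_def)
  qed
qed

text \<open>Finiteness of the edge set makes the cardinality meaningful, since \<open>card\<close>
  is 0 on infinite sets.\<close>

lemma at_least_two_cycles_iff:
  assumes "signed_graph G"
  shows "at_least_two_cycles G \<longleftrightarrow> (\<exists>C D. cycle G C \<and> cycle G D \<and> C \<noteq> D)"
proof -
  have "{C. cycle G C} \<subseteq> Pow (edges G)" by (auto simp: cycle_def)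
  then have "finite {C. cycle G C}"
    using assms finite_subset by (auto simp: signed_graph_def)
  then show ?thesis
    using card_le_Suc0_iff_eq[of "{C. cycle G C}"]
    by (auto simp: at_least_two_cycles_def not_less_eq_eq[symmetric] numeral_2_eq_2)
qed

section \<open>Equivalence of the three conditions\<close>

theorem theorem5p6:
  fixes G :: "('v, 'e) signed_graph"
  assumes "signed_graph G"
    and "\<not> (\<exists>C. positive_cycle G C)"
    and "card (edges G) \<ge> 2"
    and "\<not> (\<exists>v. isolated_vertex G v)"
  shows "(lift_connected G \<longleftrightarrow> \<not> (\<exists>e. lift_isthmus G e)) \<and>
         (\<not> (\<exists>e. lift_isthmus G e) \<longleftrightarrow> at_least_two_cycles G \<and> \<not> (\<exists>e. isthmus G e)) \<and>
         (\<not> at_least_two_cycles G \<longrightarrow> (\<forall>e\<in>edges G. lift_isthmus G e))"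
proof -
  note circuit = lift_circuit_iff[OF assms(1,2)]
  note two = at_least_two_cycles_iff[OF assms(1)]
  have ne: "edges G \<noteq> {}" using assms(3) by auto
  \<comment> \<open>By symmetry in \<open>C\<close> and \<open>D\<close>, an edge avoids being a
    lift isthmus once it lies on a cycle and another cycle exists anywhere.\<close>
  have isthmus: "lift_isthmus G e \<longleftrightarrow>
      e \<in> edges G \<and> \<not> (\<exists>C D. cycle G C \<and> cycle G D \<and> C \<noteq> D \<and> e \<in> C)" for e
    unfolding lift_isthmus_def coloop_def lift_matroid_def by (simp add: circuit) blast
  have ex: "(\<exists>A. lift_circuit G A \<and> P A) \<longleftrightarrow>
      (\<exists>C D. cycle G C \<and> cycle G D \<and> C \<noteq> D \<and> P (C \<union> D))" for P
    unfolding circuit by blast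
  have connected: "lift_connected G \<longleftrightarrow> (\<forall>x\<in>edges G. \<forall>y\<in>edges G. x \<noteq> y \<longrightarrow>
      (\<exists>C D. cycle G C \<and> cycle G D \<and> C \<noteq> D \<and> x \<in> C \<union> D \<and> y \<in> C \<union> D))"
    unfolding lift_connected_def matroid_connected_def lift_matroid_def is_K1_def
    by (simp add: ne ex)
  have 12: "\<not> (\<exists>e. lift_isthmus G e)" if conn: "lift_connected G"
  proof
    assume "\<exists>e. lift_isthmus G e"
    then obtain e where e: "lift_isthmus G e" "e \<in> edges G" using isthmus by blast
    \<comment> \<open>Matroid connectedness speaks only of pairs of distinct elements, so a second
      edge is required to get a circuit through \<open>e\<close>.\<close>
    have "\<not> edges G \<subseteq> {e}" using assms(3) card_mono[of "{e}" "edges G"] by auto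
    then obtain d where "d \<in> edges G" "d \<noteq> e" by blast
    then obtain C D where "cycle G C" "cycle G D" "C \<noteq> D" "e \<in> C \<union> D"
      using conn connected e(2) by metis
    then show False using e(1) isthmus by blast
  qed
  \<comment> \<open>Some edge exists and is not a lift isthmus, which yields two distinct cycles;
    likewise every edge lies on a cycle.\<close>
  have 23: "at_least_two_cycles G \<and> \<not> (\<exists>e. isthmus G e)" if "\<not> (\<exists>e. lift_isthmus G e)"
    using that isthmus ne two isthmus_iff_no_cycle[OF assms(1)] unfolding isthmus_def by blast
  have 31: "lift_connected G"
    if many: "at_least_two_cycles G" and no_isthmus: "\<not> (\<exists>e. isthmus G e)"
    unfolding connected
  proof (intro ballI impI)
    fix x y assume "x \<in> edges G" "y \<in> edges G"
    then obtain C D where "cycle G C" "x \<in> C" "cycle G D" "y \<in> D"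
      using no_isthmus isthmus_iff_no_cycle[OF assms(1)] by metis
    \<comment> \<open>If \<open>x\<close> and \<open>y\<close> were given the same cycle, any other
      cycle \<open>E\<close> completes it to a lift circuit.\<close>
    moreover obtain E where "cycle G E" "C \<noteq> E" using many two by metis
    ultimately show "\<exists>C D. cycle G C \<and> cycle G D \<and> C \<noteq> D \<and> x \<in> C \<union> D \<and> y \<in> C \<union> D"
      by (cases "C = D") blast+
  qed
  \<comment> \<open>Without two distinct cycles there is no lift circuit at all.\<close>
  have "lift_isthmus G e" if "\<not> at_least_two_cycles G" "e \<in> edges G" for e
    using that isthmus two by blast
  then show ?thesis using 12 23 31 by blast
qed

end
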